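(* Let $\mathcal{P}$ be a non-trivial graph property which is minor closed, or monotone, or hereditary. Then the Harary polynomial $\chi_{\mathcal{P}}(G;x)$ is an edge elimination invariant if and only if $\chi_{\mathcal{P}}(G;x)=\chi(G;x)$ for all graphs $G$, where $\chi(G;x)$ is the chromatic polynomial (equivalently, the Harary polynomial of the property consisting of all edgeless graphs).
   Context: All graphs are finite simple graphs; a graph property is a class of graphs closed under isomorphism. A graph property is trivial if it is empty, finite up to isomorphism, or contains all finite graphs; otherwise non-trivial. $\mathcal{P}$ is hereditary (monotone, minor closed) if it is closed under taking induced subgraphs (subgraphs, minors). For a graph $G$ and $i\ge 0$, let $b_i^{\mathcal{P}}(G)$ be the number of partitions of $V(G)$ into $i$ nonempty blocks such that each block induces a subgraph of $G$ belonging to $\mathcal{P}$ (so $b_0^{\mathcal{P}}(G)=1$ if $G$ is the null graph with no vertices, and $0$ otherwise). The Harary polynomial is $\chi_{\mathcal{P}}(G;x)=\sum_{i\ge 0} b_i^{\mathcal{P}}(G)\,x_{(i)}\in\mathbb{Z}[x]$, where $x_{(i)}=x(x-1)\cdots(x-i+1)$ is the falling factorial; for a positive integer $k$, $\chi_{\mathcal{P}}(G;k)$ is the number of maps $c:V(G)\to\{1,\dots,k\}$ such that every nonempty color class induces a graph in $\mathcal{P}$. For an edge $e=uv$ of $G$: $G_{-e}$ is obtained by deleting $e$; $G_{/e}$ by contracting $e$ (identifying $u$ and $v$, keeping the graph simple); $G_{\dagger e}$ (extraction) by deleting $u$, $v$ and all edges incident with $u$ or $v$. A graph parameter $F$ with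 values in $\mathbb{Z}[x]$ is an edge elimination (EE-)invariant if there exist $\alpha,\beta,\gamma\in\mathbb{Z}[x]$ such that for every graph $G$ and every edge $e\in E(G)$, $F(G)=F(G_{-e})+\alpha F(G_{/e})+\beta F(G_{\dagger e})$, and moreover $F(\emptyset)=1$ for the null graph $\emptyset$, $F(K_1)=\gamma$, and $F(G\sqcup H)=F(G)\cdot F(H)$ for all graphs $G,H$ ($\sqcup$ = disjoint union). *)

theory Defs
  imports
    "HOL-Library.FuncSet"
    "HOL-Library.Disjoint_Sets"
    "HOL-Computational_Algebra.Polynomial"
begin

section \<open>Finite simple graphs\<close>

type_synonym 'a ugraph = "'a set \<times> 'a set set"

abbreviation verts :: "'a ugraph \<Rightarrow> 'a set" where
  "verts \<equiv> fst"

abbreviation edges :: "'a ugraph \<Rightarrow> 'a set set" where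
  "edges \<equiv> snd"

definition simple_graph :: "'a ugraph \<Rightarrow> bool" where
  "simple_graph G \<longleftrightarrow> finite (verts G) \<and> (\<forall>e\<in>edges G. e \<subseteq> verts G \<and> card e = 2)"

definition graph_iso :: "'a ugraph \<Rightarrow> 'a ugraph \<Rightarrow> bool" where
  "graph_iso G H \<longleftrightarrow>
     (\<exists>f. bij_betw f (verts G) (verts H) \<and>
          (\<forall>u\<in>verts G. \<forall>v\<in>verts G. {u, v} \<in> edges G \<longleftrightarrow> {f u, f v} \<in> edges H))"

definition null_graph :: "'a ugraph" where
  "null_graph = ({}, {})"

definition induced_subgraph :: "'a ugraph \<Rightarrow> 'a set \<Rightarrow> 'a ugraph" where
  "induced_subgraph G W = (W, {e \<in> edges G. e \<subseteq> W})"

definition subgraph :: "'a ugraph \<Rightarrow> 'a ugraph \<Rightarrow> bool" where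
  "subgraph H G \<longleftrightarrow> simple_graph H \<and> verts H \<subseteq> verts G \<and> edges H \<subseteq> edges G"

definition delete_vertex :: "'a ugraph \<Rightarrow> 'a \<Rightarrow> 'a ugraph" where
  "delete_vertex G v = induced_subgraph G (verts G - {v})"

definition delete_edge :: "'a ugraph \<Rightarrow> 'a \<Rightarrow> 'a \<Rightarrow> 'a ugraph" where
  "delete_edge G u v = (verts G, edges G - {{u, v}})"

text \<open>
  The vertex arising from the identification of \<open>u\<close> and \<open>v\<close> is named \<open>u\<close>; requiring two-element
  edges removes the loop, and parallel edges merge because edges form a set.
\<close>

definition contract_edge :: "'a ugraph \<Rightarrow> 'a \<Rightarrow> 'a \<Rightarrow> 'a ugraph" where
  "contract_edge G u v =
     (verts G - {v},
      {e' \<in> (\<lambda>e. (\<lambda>w. if w = v then u else w) ` e) ` edges G. card e' = 2})"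

definition extract_edge :: "'a ugraph \<Rightarrow> 'a \<Rightarrow> 'a \<Rightarrow> 'a ugraph" where
  "extract_edge G u v = induced_subgraph G (verts G - {u, v})"

definition graph_union :: "'a ugraph \<Rightarrow> 'a ugraph \<Rightarrow> 'a ugraph" where
  "graph_union G H = (verts G \<union> verts H, edges G \<union> edges H)"

inductive minor :: "'a ugraph \<Rightarrow> 'a ugraph \<Rightarrow> bool" where
  iso: "simple_graph H \<Longrightarrow> graph_iso G H \<Longrightarrow> minor H G"
| del_vertex: "minor H G \<Longrightarrow> v \<in> verts H \<Longrightarrow> minor (delete_vertex H v) G"
| del_edge: "minor H G \<Longrightarrow> {u, v} \<in> edges H \<Longrightarrow> minor (delete_edge H u v) G"
| contract: "minor H G \<Longrightarrow> {u, v} \<in> edges H \<Longrightarrow> minor (contract_edge H u v) G"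


section \<open>Graph properties\<close>

text \<open>
  Every finite graph is isomorphic to one with vertices in \<^typ>\<open>nat\<close>, so an isomorphism-closed
  class of finite graphs is given by an isomorphism-closed set of such graphs.
\<close>

definition graph_property :: "nat ugraph set \<Rightarrow> bool" where
  "graph_property P \<longleftrightarrow>
     (\<forall>G\<in>P. simple_graph G) \<and>
     (\<forall>G\<in>P. \<forall>H. simple_graph H \<and> graph_iso G H \<longrightarrow> H \<in> P)"

definition finite_up_to_iso :: "nat ugraph set \<Rightarrow> bool" where
  "finite_up_to_iso P \<longleftrightarrow> (\<exists>S. finite S \<and> S \<subseteq> P \<and> (\<forall>G\<in>P. \<exists>H\<in>S. graph_iso G H))"

definition trivial_property :: "nat ugraph set \<Rightarrow> bool" where
  "trivial_property P \<longleftrightarrow> P = {} \<or> finite_up_to_iso P \<or> (\<forall>G. simple_graph G \<longrightarrow> G \<in> P)"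

definition hereditary_property :: "nat ugraph set \<Rightarrow> bool" where
  "hereditary_property P \<longleftrightarrow> (\<forall>G\<in>P. \<forall>W\<subseteq>verts G. induced_subgraph G W \<in> P)"

definition monotone_property :: "nat ugraph set \<Rightarrow> bool" where
  "monotone_property P \<longleftrightarrow> (\<forall>G\<in>P. \<forall>H. subgraph H G \<longrightarrow> H \<in> P)"

definition minor_closed_property :: "nat ugraph set \<Rightarrow> bool" where
  "minor_closed_property P \<longleftrightarrow> (\<forall>G\<in>P. \<forall>H. minor H G \<longrightarrow> H \<in> P)"


section \<open>Harary and chromatic polynomials\<close>

definition good_partitions :: "'a ugraph set \<Rightarrow> 'a ugraph \<Rightarrow> 'a set set set" where
  "good_partitions P G =
     {p. partition_on (verts G) p \<and> (\<forall>B\<in>p. induced_subgraph G B \<in> P)}"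

definition harary_coeff :: "'a ugraph set \<Rightarrow> nat \<Rightarrow> 'a ugraph \<Rightarrow> nat" where
  "harary_coeff P i G = card {p \<in> good_partitions P G. card p = i}"

definition falling_factorial_poly :: "nat \<Rightarrow> int poly" where
  "falling_factorial_poly i = (\<Prod>j<i. [:- int j, 1:])"

text \<open>A partition of the vertex set has at most \<open>card (verts G)\<close> blocks, so the sum is complete.\<close>

definition harary_poly :: "'a ugraph set \<Rightarrow> 'a ugraph \<Rightarrow> int poly" where
  "harary_poly P G =
     (\<Sum>i\<le>card (verts G). of_nat (harary_coeff P i G) * falling_factorial_poly i)"

definition proper_colourings :: "'a ugraph \<Rightarrow> nat \<Rightarrow> ('a \<Rightarrow> nat) set" where
  "proper_colourings G k =
     {c \<in> verts G \<rightarrow>\<^sub>E {1..k}. \<forall>u v. {u, v} \<in> edges G \<longrightarrow> c u \<noteq> c v}"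

text \<open>
  Existence and uniqueness of this polynomial follow from \<open>chromatic_poly_eqI\<close> and
  \<open>chromatic_poly_eq_harary_poly\<close> below.
\<close>

definition chromatic_poly :: "'a ugraph \<Rightarrow> int poly" where
  "chromatic_poly G =
     (THE p. \<forall>k. poly p (int k) = int (card (proper_colourings G k)))"


section \<open>Edge elimination invariants\<close>

definition graph_parameter :: "(nat ugraph \<Rightarrow> 'b) \<Rightarrow> bool" where
  "graph_parameter F \<longleftrightarrow>
     (\<forall>G H. simple_graph G \<and> simple_graph H \<and> graph_iso G H \<longrightarrow> F G = F H)"

text \<open>
  Since a graph parameter is invariant under isomorphism, multiplicativity over disjoint unions
  and the value at the one-vertex graph may be expressed through arbitrary representatives.
\<close>

definition EE_invariant :: "(nat ugraph \<Rightarrow> int poly) \<Rightarrow> bool" where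
  "EE_invariant F \<longleftrightarrow>
     graph_parameter F \<and>
     (\<exists>\<alpha> \<beta> \<gamma>.
        (\<forall>G u v. simple_graph G \<and> {u, v} \<in> edges G \<longrightarrow>
           F G = F (delete_edge G u v) + \<alpha> * F (contract_edge G u v)
                   + \<beta> * F (extract_edge G u v)) \<and>
        F null_graph = 1 \<and>
        (\<forall>v. F ({v}, {}) = \<gamma>) \<and>
        (\<forall>G H. simple_graph G \<and> simple_graph H \<and> verts G \<inter> verts H = {} \<longrightarrow>
           F (graph_union G H) = F G * F H))"


section \<open>Counting colourings\<close>

definition P_colourings :: "'a ugraph set \<Rightarrow> 'a ugraph \<Rightarrow> nat \<Rightarrow> ('a \<Rightarrow> nat) set" where
  "P_colourings P G k =
     {c \<in> verts G \<rightarrow>\<^sub>E {1..k}. \<forall>i\<in>c ` verts G. induced_subgraph G {v \<in> verts G. c v = i} \<in> P}"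

lemma simple_graph_induced_subgraph:
  "simple_graph G \<Longrightarrow> W \<subseteq> verts G \<Longrightarrow> simple_graph (induced_subgraph G W)"
  by (auto simp: simple_graph_def induced_subgraph_def intro: finite_subset)

lemma simple_graph_delete_edge:
  "simple_graph G \<Longrightarrow> simple_graph (delete_edge G u v)"
  by (auto simp: simple_graph_def delete_edge_def)

lemma simple_graph_contract_edge:
  assumes "simple_graph G" "{u, v} \<in> edges G"
  shows "simple_graph (contract_edge G u v)"
proof -
  have "u \<in> verts G" "u \<noteq> v"
    using assms by (auto simp: simple_graph_def)
  with assms(1) show ?thesis
    unfolding simple_graph_def contract_edge_def by fastforce
qed

lemma minor_simple_graph: "minor H G \<Longrightarrow> simple_graph H"
  by (induction rule: minor.induct)
     (auto simp: delete_vertex_def simple_graph_delete_edge simple_graph_contract_edge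
           intro: simple_graph_induced_subgraph)

lemma poly_falling_factorial_poly:
  "poly (falling_factorial_poly i) (int k) = int (\<Prod>j<i. k - j)"
proof (cases "i \<le> k")
  case True
  then show ?thesis
    by (auto simp: falling_factorial_poly_def poly_prod of_nat_diff intro!: prod.cong)
next
  case False
  then have "k \<in> {..<i}" by auto
  then have "(\<Prod>j<i. poly [:- int j, 1:] (int k)) = 0" and "(\<Prod>j<i. k - j) = 0"
    by (force intro!: prod_zero)+
  then show ?thesis
    by (simp only: falling_factorial_poly_def poly_prod of_nat_0)
qed

lemma card_partition_on_le:
  assumes "finite A" "partition_on A p"
  shows "card p \<le> card A"
proof -
  have ne: "\<And>B. B \<in> p \<Longrightarrow> \<exists>x. x \<in> B"
    using partition_onD3[OF assms(2)] by (metis ex_in_conv)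
  then obtain r where r: "\<And>B. B \<in> p \<Longrightarrow> r B \<in> B" by metis
  have "inj_on r p"
    using r partition_onD2[OF assms(2)] by (intro inj_onI) (metis disjointD disjoint_iff)
  moreover have "r ` p \<subseteq> A"
    using r partition_onD1[OF assms(2)] by auto
  ultimately show ?thesis
    using assms(1) by (rule card_inj_on_le)
qed

lemma card_P_colourings:
  assumes "finite (verts G)"
  shows "card (P_colourings P G k) = (\<Sum>p\<in>good_partitions P G. \<Prod>j<card p. k - j)"
proof -
  define V where "V = verts G"
  define blk where "blk = (\<lambda>p v. THE B. B \<in> p \<and> v \<in> (B :: 'a set))"
  have finV: "finite V" using assms by (simp add: V_def)
  define S where
    "S = Sigma (good_partitions P G) (\<lambda>p. {f \<in> p \<rightarrow>\<^sub>E {1..k}. inj_on f p})"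
  define \<Phi> where "\<Phi> = (\<lambda>(p, f). \<lambda>v\<in>V. f (blk p v) :: nat)"
  have part: "partition_on V p" if "p \<in> good_partitions P G" for p
    using that by (auto simp: good_partitions_def V_def)
  have blk: "blk p v = B" if "partition_on V p" "B \<in> p" "v \<in> B" for p v B
    unfolding blk_def
  proof (rule the_equality)
    show "C = B" if "C \<in> p \<and> v \<in> C" for C
      using that partition_onD2[OF \<open>partition_on V p\<close>] \<open>B \<in> p\<close> \<open>v \<in> B\<close>
      by (metis disjointD disjoint_iff)
  qed (use that in auto)
  have blk_in: "blk p v \<in> p" "v \<in> blk p v" if pv: "partition_on V p" "v \<in> V" for p v
  proof -
    obtain B where "B \<in> p" "v \<in> B" using pv(2) partition_onD1[OF pv(1)] by blast
    then show "blk p v \<in> p" "v \<in> blk p v" using blk[OF pv(1)] by auto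
  qed
  have class_eq: "{w \<in> V. f (blk p w) = f B} = B"
    if "partition_on V p" "inj_on f p" "B \<in> p" for p f B
  proof -
    have "B \<subseteq> V" using that partition_onD1 by fastforce
    moreover have "w \<in> B" if "w \<in> V" "f (blk p w) = f B" for w
      using blk_in[OF \<open>partition_on V p\<close> \<open>w \<in> V\<close>] that \<open>B \<in> p\<close>
        inj_onD[OF \<open>inj_on f p\<close>, of "blk p w" B] by simp
    ultimately show ?thesis
      using blk[OF that(1,3)] by auto
  qed
  have recover: "p = (\<lambda>i. {w \<in> V. \<Phi> (p, f) w = i}) ` (\<Phi> (p, f) ` V)"
    and vals: "\<And>B. B \<in> p \<Longrightarrow> {w \<in> V. \<Phi> (p, f) w = f B} = B"
    if pf: "partition_on V p" "inj_on f p" for p f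
  proof -
    show vals: "{w \<in> V. \<Phi> (p, f) w = f B} = B" if "B \<in> p" for B
      using class_eq[OF pf that] by (auto simp: \<Phi>_def)
    have "\<Phi> (p, f) ` V = f ` p"
    proof -
      have "\<exists>v\<in>V. blk p v = B" if "B \<in> p" for B
      proof -
        have "B \<noteq> {}" using partition_onD3[OF pf(1)] that by auto
        then obtain v where "v \<in> B" by auto
        moreover have "B \<subseteq> V" using pf(1) that partition_onD1 by fastforce
        ultimately show ?thesis using blk[OF pf(1) that] by auto
      qed
      then show ?thesis using blk_in[OF pf(1)] by (force simp: \<Phi>_def image_iff)
    qed
    then show "p = (\<lambda>i. {w \<in> V. \<Phi> (p, f) w = i}) ` (\<Phi> (p, f) ` V)"
      using vals by (simp add: image_image)
  qed
  have inj: "inj_on \<Phi> S"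
  proof (rule inj_onI)
    fix x y assume xy: "x \<in> S" "y \<in> S" "\<Phi> x = \<Phi> y"
    obtain p f q g where pq: "x = (p, f)" "y = (q, g)" by (cases x, cases y) auto
    have p: "partition_on V p" "inj_on f p" "f \<in> extensional p"
      and q: "partition_on V q" "inj_on g q" "g \<in> extensional q"
      using xy part by (auto simp: S_def pq PiE_def)
    have "p = q"
      using recover[OF p(1,2)] recover[OF q(1,2)] xy(3) by (simp add: pq)
    moreover have "f = g"
    proof (rule extensionalityI)
      show "f \<in> extensional p" "g \<in> extensional p"
        using p q \<open>p = q\<close> by auto
      fix B assume B: "B \<in> p"
      then obtain v where v: "v \<in> B" using partition_onD3[OF p(1)] by fastforce
      have "v \<in> V" using v B p(1) partition_onD1 by fastforce
      then have "\<Phi> (p, f) v = f B" "\<Phi> (p, g) v = g B"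
        using blk[OF p(1) B v] by (auto simp: \<Phi>_def)
      then show "f B = g B" using xy(3) \<open>p = q\<close> by (simp add: pq)
    qed
    ultimately show "x = y" by (simp add: pq)
  qed
  have img: "\<Phi> ` S = P_colourings P G k"
  proof (intro equalityI subsetI)
    fix c assume "c \<in> \<Phi> ` S"
    then obtain p f where pf: "p \<in> good_partitions P G" "f \<in> p \<rightarrow>\<^sub>E {1..k}" "inj_on f p"
      and c: "c = \<Phi> (p, f)" by (auto simp: S_def)
    note pp = part[OF pf(1)]
    have cV: "c \<in> V \<rightarrow>\<^sub>E {1..k}"
      using pf(2) blk_in[OF pp] by (auto simp: c \<Phi>_def PiE_def Pi_def)
    have "{w \<in> V. c w = i} \<in> p" if "i \<in> c ` V" for i
      using recover[OF pp pf(3)] that unfolding c by blast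
    then show "c \<in> P_colourings P G k"
      using cV pf(1) by (auto simp: P_colourings_def good_partitions_def V_def)
  next
    fix c assume c: "c \<in> P_colourings P G k"
    then have cV: "c \<in> V \<rightarrow>\<^sub>E {1..k}"
      and cP: "\<And>i. i \<in> c ` V \<Longrightarrow> induced_subgraph G {v \<in> V. c v = i} \<in> P"
      by (auto simp: P_colourings_def V_def)
    define p where "p = (\<lambda>i. {w \<in> V. c w = i}) ` (c ` V)"
    define f where "f = (\<lambda>B\<in>p. THE i. \<exists>v\<in>B. c v = i)"
    have f: "f {w \<in> V. c w = c v} = c v" if "v \<in> V" for v
      using that by (auto simp: f_def p_def intro!: the_equality)
    have pp: "partition_on V p"
      by (auto simp: partition_on_def p_def disjoint_def)
    have "p \<in> good_partitions P G"
      using pp cP by (auto simp: good_partitions_def p_def V_def)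
    moreover have "f \<in> p \<rightarrow>\<^sub>E {1..k}"
    proof (rule PiE_I)
      fix B assume "B \<in> p"
      then obtain v where "v \<in> V" "B = {w \<in> V. c w = c v}" by (auto simp: p_def)
      then show "f B \<in> {1..k}" using f cV by (auto simp: PiE_def Pi_def)
    qed (auto simp: f_def)
    moreover have "inj_on f p"
      by (auto simp: inj_on_def p_def f)
    moreover have "c = \<Phi> (p, f)"
    proof (rule extensionalityI)
      show "c \<in> extensional V" using cV by (auto simp: PiE_def)
      show "\<Phi> (p, f) \<in> extensional V" by (auto simp: \<Phi>_def)
      fix v assume v: "v \<in> V"
      have "blk p v = {w \<in> V. c w = c v}"
        by (rule blk[OF pp]) (use v in \<open>auto simp: p_def\<close>)
      then show "c v = \<Phi> (p, f) v" using v f by (simp add: \<Phi>_def)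
    qed
    ultimately show "c \<in> \<Phi> ` S" by (auto simp: S_def)
  qed
  have fin: "finite (good_partitions P G)"
    by (rule finite_subset[OF _ finitely_many_partition_on[OF finV]])
       (auto simp: good_partitions_def V_def)
  have finp: "finite p" if "p \<in> good_partitions P G" for p
    using finite_elements[OF finV part[OF that]] .
  have "card (P_colourings P G k) = card S"
    using card_image[OF inj] by (simp add: img)
  also have "\<dots> = (\<Sum>p\<in>good_partitions P G. card {f \<in> p \<rightarrow>\<^sub>E {1..k}. inj_on f p})"
    unfolding S_def
    by (rule card_SigmaI) (simp_all add: fin finp finite_PiE)
  also have "\<dots> = (\<Sum>p\<in>good_partitions P G. \<Prod>j<card p. k - j)"
  proof (rule sum.cong[OF refl])
    fix p assume p: "p \<in> good_partitions P G"
    show "card {f \<in> p \<rightarrow>\<^sub>E {1..k}. inj_on f p} = (\<Prod>j<card p. k - j)"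
      using card_inj_on_subset_funcset[of p "{1..k}" p] finp[OF p]
      by (simp add: atLeast0LessThan)
  qed
  finally show ?thesis .
qed

theorem poly_harary_poly:
  assumes "simple_graph G"
  shows "poly (harary_poly P G) (int k) = int (card (P_colourings P G k))"
proof -
  have finV: "finite (verts G)" using assms by (simp add: simple_graph_def)
  have fin: "finite (good_partitions P G)"
    by (rule finite_subset[OF _ finitely_many_partition_on[OF finV]])
       (auto simp: good_partitions_def)
  have "(\<Sum>p\<in>good_partitions P G. \<Prod>j<card p. k - j) =
        (\<Sum>i\<le>card (verts G). \<Sum>p\<in>{p \<in> good_partitions P G. card p = i}. \<Prod>j<card p. k - j)"
    by (rule sum.group[symmetric, OF fin])
       (auto simp: good_partitions_def intro: card_partition_on_le[OF finV])
  also have "\<dots> = (\<Sum>i\<le>card (verts G). harary_coeff P i G * (\<Prod>j<i. k - j))"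
    by (rule sum.cong) (auto simp: harary_coeff_def)
  finally have "int (card (P_colourings P G k)) =
      (\<Sum>i\<le>card (verts G). int (harary_coeff P i G) * int (\<Prod>j<i. k - j))"
    by (simp add: card_P_colourings[OF finV])
  then show ?thesis
    by (simp add: harary_poly_def poly_sum poly_falling_factorial_poly)
qed

lemma poly_eqI_nat:
  fixes p q :: "int poly"
  assumes "\<And>k. poly p (int k) = poly q (int k)"
  shows "p = q"
proof (rule ccontr)
  assume "p \<noteq> q"
  then have "finite {x. poly (p - q) x = 0}" by (intro poly_roots_finite) auto
  moreover have "range int \<subseteq> {x. poly (p - q) x = 0}" using assms by auto
  ultimately have "finite (range int)" by (rule rev_finite_subset)
  then show False by (auto dest: finite_imageD)
qed

lemma chromatic_poly_eqI:
  assumes "\<And>k. poly p (int k) = int (card (proper_colourings G k))"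
  shows "chromatic_poly G = p"
  unfolding chromatic_poly_def
  by (rule the_equality) (use assms in \<open>auto intro: poly_eqI_nat\<close>)

theorem chromatic_poly_eq_harary_poly:
  assumes "simple_graph G"
  shows "chromatic_poly G = harary_poly {H. simple_graph H \<and> edges H = {}} G"
proof (rule chromatic_poly_eqI)
  fix k
  let ?E = "{H :: 'a ugraph. simple_graph H \<and> edges H = {}}"
  have "proper_colourings G k = P_colourings ?E G k"
  proof -
    have "(\<forall>u v. {u, v} \<in> edges G \<longrightarrow> c u \<noteq> c v) \<longleftrightarrow>
          (\<forall>i\<in>c ` verts G. induced_subgraph G {v \<in> verts G. c v = i} \<in> ?E)" (is "?L \<longleftrightarrow> ?R")
      for c :: "'a \<Rightarrow> nat"
    proof
      assume L: ?L
      have "e \<notin> edges G" if "e \<subseteq> {v \<in> verts G. c v = i}" for e i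
      proof
        assume e: "e \<in> edges G"
        then have "card e = 2" using assms by (auto simp: simple_graph_def)
        then obtain u v where "e = {u, v}" by (auto simp: card_2_iff)
        then show False using L e that by blast
      qed
      then have "edges (induced_subgraph G {v \<in> verts G. c v = i}) = {}" for i
        by (auto simp: induced_subgraph_def)
      then show ?R using assms by (auto intro: simple_graph_induced_subgraph)
    next
      assume R: ?R
      show ?L
      proof (intro allI impI notI)
        fix u v assume e: "{u, v} \<in> edges G" and c: "c u = c v"
        then have uv: "u \<in> verts G" "v \<in> verts G" using assms by (auto simp: simple_graph_def)
        then have "edges (induced_subgraph G {w \<in> verts G. c w = c u}) = {}" using R by auto
        then show False using e c uv by (auto simp: induced_subgraph_def)
      qed
    qed
    then show ?thesis by (auto simp: proper_colourings_def P_colourings_def)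
  qed
  then show "poly (harary_poly ?E G) (int k) = int (card (proper_colourings G k))"
    by (simp add: poly_harary_poly[OF assms])
qed

end

theory Submission
  imports Defs
begin

text \<open>
  All three closure conditions imply that \<open>P\<close> is hereditary. Evaluated at \<open>1\<close>, the Harary polynomial
  is the indicator function of \<open>P\<close>. So if it is an edge elimination invariant, then \<open>P\<close> is closed
  under disjoint unions and contains all edgeless graphs. If \<open>P\<close> contained a graph with an edge, it
  would contain \<open>K\<^sub>2\<close>, and the recurrence for \<open>K\<^sub>2\<close> at \<open>1\<close> would read \<open>1 = 1 + \<alpha>(1) + \<beta>(1)\<close>. But for
  a graph outside \<open>P\<close> that has the fewest vertices and, among those, the fewest edges, the
  recurrence reads \<open>0 = 1 + \<alpha>(1) + \<beta>(1)\<close>. Hence \<open>P\<close> is the class of edgeless graphs.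
\<close>

section \<open>Hereditary properties\<close>

lemma induced_subgraph_verts: "simple_graph G \<Longrightarrow> induced_subgraph G (verts G) = G"
  by (cases G) (auto simp: induced_subgraph_def simple_graph_def)

lemma induced_subgraph_singleton:
  assumes "simple_graph G"
  shows "induced_subgraph G {v} = ({v}, {})"
proof -
  have "\<not> e \<subseteq> {v}" if "e \<in> edges G" for e
    using that assms card_mono[of "{v}" e] by (auto simp: simple_graph_def)
  then show ?thesis by (auto simp: induced_subgraph_def)
qed

lemma induced_subgraph_edge:
  assumes "simple_graph G" "{u, v} \<in> edges G"
  shows "induced_subgraph G {u, v} = ({u, v}, {{u, v}})"
proof -
  have "e = {u, v}" if "e \<in> edges G" "e \<subseteq> {u, v}" for e
    using that assms by (intro card_subset_eq) (auto simp: simple_graph_def)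
  then show ?thesis using assms(2) by (auto simp: induced_subgraph_def)
qed

section \<open>Reducing the closure conditions to heredity\<close>

lemma monotone_imp_hereditary:
  assumes "graph_property P" "monotone_property P"
  shows "hereditary_property P"
  unfolding hereditary_property_def
proof (intro ballI allI impI)
  fix G W assume "G \<in> P" "W \<subseteq> verts G"
  moreover from this have "subgraph (induced_subgraph G W) G"
    using assms(1) simple_graph_induced_subgraph[of G W]
    by (auto simp: graph_property_def subgraph_def induced_subgraph_def)
  ultimately show "induced_subgraph G W \<in> P"
    using assms(2) unfolding monotone_property_def by blast
qed

text \<open>\<open>minor\<close> removes one vertex at a time, so a whole set is removed by
  induction on it.\<close>

lemma minor_induced_subgraph_Diff:
  assumes "simple_graph G" "finite D" "D \<subseteq> verts G"
  shows "minor (induced_subgraph G (verts G - D)) G"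
  using assms(2,3)
proof (induction D)
  case empty
  \<comment> \<open>\<open>minor\<close> starts from isomorphic copies, so its reflexivity comes
    from the identity map.\<close>
  have "graph_iso G G"
    unfolding graph_iso_def by (rule exI[of _ id]) auto
  then show ?case using assms(1) by (simp add: induced_subgraph_verts minor.iso)
next
  case (insert v D)
  let ?H = "induced_subgraph G (verts G - D)"
  have "delete_vertex ?H v = induced_subgraph G (verts G - insert v D)"
    by (auto simp: delete_vertex_def induced_subgraph_def)
  moreover have "minor (delete_vertex ?H v) G"
    using insert by (intro minor.del_vertex) (auto simp: induced_subgraph_def)
  ultimately show ?case by simp
qed

lemma minor_closed_imp_hereditary:
  assumes "graph_property P" "minor_closed_property P"
  shows "hereditary_property P"
  unfolding hereditary_property_def
proof (intro ballI allI impI)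
  fix G W assume GW: "G \<in> P" "W \<subseteq> verts G"
  then have "simple_graph G" using assms(1) by (auto simp: graph_property_def)
  moreover have "finite (verts G - W)" using \<open>simple_graph G\<close> by (auto simp: simple_graph_def)
  ultimately have "minor (induced_subgraph G (verts G - (verts G - W))) G"
    by (intro minor_induced_subgraph_Diff) auto
  then have "minor (induced_subgraph G W) G" using GW(2) by (simp add: double_diff)
  then show "induced_subgraph G W \<in> P"
    using assms(2) GW(1) unfolding minor_closed_property_def by blast
qed

text \<open>Supplies the member from which heredity extracts the null graph and a one-vertex graph.
  A property without such a member contains at most \<open>null_graph\<close>, hence is
  finite.\<close>

lemma infinite_property_nonempty_graph:
  assumes "graph_property P" "\<not> finite_up_to_iso P"
  obtains G v where "G \<in> P" "v \<in> verts G"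
proof -
  have "P \<subseteq> {null_graph}" if "\<And>G v. G \<in> P \<Longrightarrow> v \<notin> verts G"
  proof
    fix G assume G: "G \<in> P"
    then have "simple_graph G" "verts G = {}" using assms(1) that unfolding graph_property_def by blast+
    then show "G \<in> {null_graph}"
      by (cases G) (auto simp: simple_graph_def null_graph_def)
  qed
  moreover have "finite_up_to_iso P" if "finite P"
    unfolding finite_up_to_iso_def graph_iso_def using that
    by (intro exI[of _ P] conjI ballI bexI[rotated] exI[of _ id]) auto
  ultimately show ?thesis using assms(2) that by (meson finite.simps finite_subset)
qed

section \<open>The chromatic polynomial is an edge elimination invariant\<close>

lemma proper_colourings_eq_P_colourings:
  assumes "simple_graph G"
  shows "proper_colourings G k = P_colourings {H. simple_graph H \<and> edges H = {}} G k"
proof -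
  have *: "(\<forall>u v. {u, v} \<in> edges G \<longrightarrow> c u \<noteq> c v) \<longleftrightarrow>
      (\<forall>i\<in>c ` verts G. \<forall>e\<in>edges G. \<not> e \<subseteq> {v \<in> verts G. c v = i})" for c :: "'a \<Rightarrow> nat"
  proof -
    have e: "\<exists>u v. e = {u, v}" if "e \<in> edges G" for e
    proof -
      have "card e = 2" using that assms by (simp add: simple_graph_def)
      then show ?thesis by (auto simp: card_2_iff)
    qed
    have uv: "u \<in> verts G" "v \<in> verts G" if "{u, v} \<in> edges G" for u v
      using that assms by (auto simp: simple_graph_def)
    show ?thesis
    proof safe
      fix w f assume L: "\<forall>u v. {u, v} \<in> edges G \<longrightarrow> c u \<noteq> c v"
        and f: "f \<in> edges G" "f \<subseteq> {v \<in> verts G. c v = c w}"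
      obtain u v where "f = {u, v}" using e[OF f(1)] by blast
      then have "c u = c v" "{u, v} \<in> edges G" using f by auto
      then show False using L by blast
    next
      fix u v assume R: "\<forall>i\<in>c ` verts G. \<forall>e\<in>edges G. \<not> e \<subseteq> {v \<in> verts G. c v = i}"
        and "{u, v} \<in> edges G" "c u = c v"
      then have "{u, v} \<subseteq> {w \<in> verts G. c w = c u}" "c u \<in> c ` verts G"
        using uv[of u v] by auto
      then show False using R \<open>{u, v} \<in> edges G\<close> by blast
    qed
  qed
  show ?thesis
    unfolding proper_colourings_def P_colourings_def *
    using simple_graph_induced_subgraph[OF assms] by (auto simp: induced_subgraph_def)
qed

text \<open>Being a Harary polynomial, \<open>chromatic_poly\<close> does satisfy its definite
  description. Together with \<open>poly_eqI_nat\<close> this turns identities of chromatic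
  polynomials into counting of colourings.\<close>

lemma poly_chromatic_poly:
  "simple_graph G \<Longrightarrow> poly (chromatic_poly G) (int k) = int (card (proper_colourings G k))"
  by (simp add: chromatic_poly_eq_harary_poly poly_harary_poly proper_colourings_eq_P_colourings)

section \<open>Isomorphism invariance\<close>

lemma finite_proper_colourings: "simple_graph G \<Longrightarrow> finite (proper_colourings G k)"
  by (auto simp: proper_colourings_def simple_graph_def intro: finite_subset[OF _ finite_PiE])

text \<open>Pulling colourings of \<open>H\<close> back along \<open>f\<close> is injective because
  \<open>f\<close> is onto, and keeps them proper because \<open>f\<close> maps edges to edges. For
  an isomorphism, \<open>f\<close> and its inverse give both inequalities.\<close>

lemma card_proper_colourings_iso_le:
  assumes "simple_graph G" "simple_graph H" "bij_betw f (verts G) (verts H)"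
    and "\<And>u v. u \<in> verts G \<Longrightarrow> v \<in> verts G \<Longrightarrow> {u, v} \<in> edges G \<Longrightarrow> {f u, f v} \<in> edges H"
  shows "card (proper_colourings H k) \<le> card (proper_colourings G k)"
proof (rule card_inj_on_le)
  let ?r = "\<lambda>c. restrict (c \<circ> f) (verts G)"
  show "inj_on ?r (proper_colourings H k)"
  proof (rule inj_onI)
    fix c d assume cd: "c \<in> proper_colourings H k" "d \<in> proper_colourings H k" "?r c = ?r d"
    show "c = d"
    proof (rule extensionalityI[of _ "verts H"])
      fix w assume "w \<in> verts H"
      then obtain v where "v \<in> verts G" "w = f v" using assms(3) by (auto simp: bij_betw_def)
      then show "c w = d w" using fun_cong[OF cd(3), of v] by simp
    qed (use cd in \<open>auto simp: proper_colourings_def PiE_def\<close>)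
  qed
  show "?r ` proper_colourings H k \<subseteq> proper_colourings G k"
  proof safe
    fix c assume c: "c \<in> proper_colourings H k"
    have "{u, v} \<subseteq> verts G" if "{u, v} \<in> edges G" for u v
      using that assms(1) by (auto simp: simple_graph_def)
    moreover have "f v \<in> verts H" if "v \<in> verts G" for v
      using that assms(3) by (auto simp: bij_betw_def)
    ultimately show "?r c \<in> proper_colourings G k"
      using c assms(4) unfolding proper_colourings_def by (fastforce simp: PiE_def Pi_def)
  qed
qed (rule finite_proper_colourings[OF assms(1)])

lemma chromatic_poly_iso:
  assumes "simple_graph G" "simple_graph H" "graph_iso G H"
  shows "chromatic_poly G = chromatic_poly H"
proof (rule poly_eqI_nat)
  fix k
  obtain f where f: "bij_betw f (verts G) (verts H)"
    and e: "\<And>u v. u \<in> verts G \<Longrightarrow> v \<in> verts G \<Longrightarrow> {u, v} \<in> edges G \<longleftrightarrow> {f u, f v} \<in> edges H"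
    using assms(3) by (auto simp: graph_iso_def)
  let ?g = "inv_into (verts G) f"
  have "card (proper_colourings H k) \<le> card (proper_colourings G k)"
    using card_proper_colourings_iso_le[OF assms(1,2) f] e by blast
  moreover have "card (proper_colourings G k) \<le> card (proper_colourings H k)"
  proof (rule card_proper_colourings_iso_le[OF assms(2,1) bij_betw_inv_into[OF f]])
    fix u v assume "u \<in> verts H" "v \<in> verts H" "{u, v} \<in> edges H"
    then show "{?g u, ?g v} \<in> edges G"
      using f e[of "?g u" "?g v"]
      by (simp add: bij_betw_inv_into_right bij_betw_apply[OF bij_betw_inv_into])
  qed
  ultimately show "poly (chromatic_poly G) (int k) = poly (chromatic_poly H) (int k)"
    using assms by (simp add: poly_chromatic_poly)
qed

section \<open>Deletion and contraction\<close>

text \<open>A proper colouring of the graph without \<open>{u, v}\<close> either separates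
  \<open>u\<close> and \<open>v\<close>, and is then proper for \<open>G\<close>, or identifies
  their colours, and is then a colouring of the contraction.\<close>

lemma card_proper_colourings_delete_edge:
  assumes "simple_graph G" "{u, v} \<in> edges G"
  shows "card (proper_colourings (delete_edge G u v) k) =
         card (proper_colourings G k) + card (proper_colourings (contract_edge G u v) k)"
proof -
  let ?D = "proper_colourings (delete_edge G u v) k"
  let ?C = "proper_colourings (contract_edge G u v) k"
  let ?S = "{c \<in> ?D. c u = c v}"
  have uv: "u \<in> verts G" "v \<in> verts G" "u \<noteq> v"
    using assms by (auto simp: simple_graph_def)
  have edge: "x \<in> verts G" "y \<in> verts G" "x \<noteq> y" if "{x, y} \<in> edges G" for x y
    using that assms(1) by (auto simp: simple_graph_def)
  define r where "r = (\<lambda>w. if w = v then u else w)"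
  \<comment> \<open>The image of an edge under \<open>r\<close> is an unordered pair; here its ends
    are matched with those of a preimage edge. \<open>x \<noteq> y\<close> stands for the
    two-element condition that discards the loop.\<close>
  have contract: "{x, y} \<in> edges (contract_edge G u v) \<longleftrightarrow>
      x \<noteq> y \<and> (\<exists>a b. {a, b} \<in> edges G \<and> x = r a \<and> y = r b)" for x y
  proof
    assume xy: "{x, y} \<in> edges (contract_edge G u v)"
    then obtain e where e: "e \<in> edges G" "{x, y} = r ` e" "card {x, y} = 2"
      by (auto simp: contract_edge_def r_def)
    then obtain a b where "e = {a, b}" using assms(1) by (auto simp: simple_graph_def card_2_iff)
    then show "x \<noteq> y \<and> (\<exists>a b. {a, b} \<in> edges G \<and> x = r a \<and> y = r b)"
      using e by (auto simp: doubleton_eq_iff) (metis insert_commute)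
  next
    assume "x \<noteq> y \<and> (\<exists>a b. {a, b} \<in> edges G \<and> x = r a \<and> y = r b)"
    then obtain a b where "x \<noteq> y" "{a, b} \<in> edges G" "x = r a" "y = r b" by blast
    moreover from this have "{x, y} = r ` {a, b}" by simp
    ultimately have "{x, y} \<in> image r ` edges G" "card {x, y} = 2" by (blast, simp)
    then show "{x, y} \<in> edges (contract_edge G u v)"
      unfolding contract_edge_def r_def by simp
  qed
  have split: "?D = proper_colourings G k \<union> ?S"
  proof (intro equalityI subsetI)
    fix c assume c: "c \<in> ?D"
    then have "c a \<noteq> c b" if "{a, b} \<in> edges G" "{a, b} \<noteq> {u, v}" for a b
      using that by (simp add: proper_colourings_def delete_edge_def)
    moreover have "c a \<noteq> c b" if "{a, b} = {u, v}" "c u \<noteq> c v" for a b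
      using that by (auto simp: doubleton_eq_iff)
    ultimately have "\<forall>a b. {a, b} \<in> edges G \<longrightarrow> c a \<noteq> c b" if "c u \<noteq> c v"
      using that by metis
    then show "c \<in> proper_colourings G k \<union> ?S"
      using c by (cases "c u = c v") (simp_all add: proper_colourings_def delete_edge_def)
  qed (auto simp: proper_colourings_def delete_edge_def)
  have disj: "proper_colourings G k \<inter> ?S = {}"
    using assms(2) by (auto simp: proper_colourings_def)
  \<comment> \<open>The colour of \<open>v\<close> can be forgotten, as it is recovered from that of
    \<open>u\<close>.\<close>
  have "bij_betw (\<lambda>c. restrict c (verts G - {v})) ?S ?C"
  proof (rule bij_betw_byWitness[where f' = "\<lambda>c. c(v := c u)"])
    show "\<forall>c\<in>?S. (restrict c (verts G - {v}))(v := restrict c (verts G - {v}) u) = c"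
      using uv by (auto simp: proper_colourings_def delete_edge_def fun_eq_iff PiE_def extensional_def)
    show "\<forall>c\<in>?C. restrict (c(v := c u)) (verts G - {v}) = c"
      by (auto simp: proper_colourings_def contract_edge_def fun_eq_iff PiE_def extensional_def)
    show "(\<lambda>c. restrict c (verts G - {v})) ` ?S \<subseteq> ?C"
    proof safe
      fix c assume c: "c \<in> ?D" "c u = c v"
      let ?c = "restrict c (verts G - {v})"
      have rc: "?c (r w) = c w" if "w \<in> verts G" for w
        using that c(2) uv by (simp add: r_def)
      have "?c x \<noteq> ?c y" if xy: "{x, y} \<in> edges (contract_edge G u v)" for x y
      proof -
        obtain a b where ab: "x \<noteq> y" "{a, b} \<in> edges G" "x = r a" "y = r b"
          using xy contract[of x y] by auto
        \<comment> \<open>The edge \<open>{u, v}\<close> itself would give \<open>x = y\<close>,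
          since \<open>r\<close> sends both ends to \<open>u\<close>.\<close>
        then have "{a, b} \<noteq> {u, v}" by (auto simp: r_def doubleton_eq_iff)
        then have "c a \<noteq> c b" using ab c(1) by (simp add: proper_colourings_def delete_edge_def)
        then show ?thesis using ab rc edge by simp
      qed
      then show "?c \<in> ?C"
        using c(1) by (auto simp: proper_colourings_def contract_edge_def delete_edge_def)
    qed
    show "(\<lambda>c. c(v := c u)) ` ?C \<subseteq> ?S"
    proof safe
      fix c assume c: "c \<in> ?C"
      let ?c = "c(v := c u)"
      \<comment> \<open>\<open>?c\<close> is \<open>c\<close> composed with \<open>r\<close>, and
        \<open>r\<close> merges the ends of no edge but \<open>{u, v}\<close>.\<close>
      have "?c a \<noteq> ?c b" if "{a, b} \<in> edges G" "{a, b} \<noteq> {u, v}" for a b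
      proof -
        have "r a \<noteq> r b" using that edge[OF that(1)] by (auto simp: r_def split: if_splits)
        then have "c (r a) \<noteq> c (r b)"
          using that(1) c contract[of "r a" "r b"] unfolding proper_colourings_def by blast
        then show ?thesis by (auto simp: r_def split: if_splits)
      qed
      moreover have "?c \<in> verts G \<rightarrow>\<^sub>E {1..k}"
        using c uv by (auto simp: proper_colourings_def contract_edge_def PiE_def Pi_def extensional_def)
      ultimately show "?c \<in> ?D" by (auto simp: proper_colourings_def delete_edge_def)
    qed (use uv in auto)
  qed
  then have "card ?S = card ?C" by (rule bij_betw_same_card)
  moreover have "finite ?S"
    using finite_proper_colourings[OF simple_graph_delete_edge[OF assms(1)]] by simp
  ultimately show ?thesis
    using disj finite_proper_colourings[OF assms(1)] by (subst split) (simp add: card_Un_disjoint)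
qed

section \<open>Multiplicativity over disjoint unions\<close>

lemma card_proper_colourings_union:
  assumes "simple_graph G" "simple_graph H" "verts G \<inter> verts H = {}"
  shows "card (proper_colourings (graph_union G H) k) =
         card (proper_colourings G k) * card (proper_colourings H k)"
proof -
  let ?U = "proper_colourings (graph_union G H) k"
  have G: "x \<in> verts G" "y \<in> verts G" if "{x, y} \<in> edges G" for x y
    using that assms(1) by (auto simp: simple_graph_def)
  \<comment> \<open>The gluing map below tests membership in \<open>verts G\<close> first, so the
    ends of an edge of \<open>H\<close> must also be known to avoid \<open>verts G\<close>.\<close>
  have H: "x \<in> verts H" "y \<in> verts H" "x \<notin> verts G" "y \<notin> verts G" if "{x, y} \<in> edges H" for x y
  proof -
    have "{x, y} \<subseteq> verts H" using that assms(2) unfolding simple_graph_def by blast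
    then show "x \<in> verts H" "y \<in> verts H" "x \<notin> verts G" "y \<notin> verts G" using assms(3) by auto
  qed
  have "bij_betw (\<lambda>c. (restrict c (verts G), restrict c (verts H))) ?U
      (proper_colourings G k \<times> proper_colourings H k)"
  proof (rule bij_betw_byWitness[where f' = "\<lambda>(c, d) v. if v \<in> verts G then c v else d v"])
    show "\<forall>c\<in>?U. (case (restrict c (verts G), restrict c (verts H)) of
        (c, d) \<Rightarrow> \<lambda>v. if v \<in> verts G then c v else d v) = c"
      by (auto simp: proper_colourings_def graph_union_def fun_eq_iff PiE_def extensional_def)
    show "\<forall>x\<in>proper_colourings G k \<times> proper_colourings H k.
        (restrict (case x of (c, d) \<Rightarrow> \<lambda>v. if v \<in> verts G then c v else d v) (verts G),
         restrict (case x of (c, d) \<Rightarrow> \<lambda>v. if v \<in> verts G then c v else d v) (verts H)) = x"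
      using assms(3)
      by (auto simp: proper_colourings_def fun_eq_iff PiE_def extensional_def)
    show "(\<lambda>c. (restrict c (verts G), restrict c (verts H))) ` ?U
        \<subseteq> proper_colourings G k \<times> proper_colourings H k"
      using G H by (auto simp: proper_colourings_def graph_union_def)
    show "(\<lambda>(c, d) v. if v \<in> verts G then c v else d v) `
        (proper_colourings G k \<times> proper_colourings H k) \<subseteq> ?U"
      using G H
      by (auto simp: proper_colourings_def graph_union_def PiE_def Pi_def extensional_def)
  qed
  then have "card ?U = card (proper_colourings G k \<times> proper_colourings H k)"
    by (rule bij_betw_same_card)
  then show ?thesis by (simp add: card_cartesian_product)
qed

lemma simple_graph_union:
  "simple_graph G \<Longrightarrow> simple_graph H \<Longrightarrow> simple_graph (graph_union G H)"
  by (auto simp: simple_graph_def graph_union_def)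

text \<open>The empty partition has no block to test, so this holds for every
  \<open>P\<close>.\<close>

lemma harary_poly_null_graph: "harary_poly P null_graph = 1"
proof -
  have "{p \<in> good_partitions P null_graph. card p = 0} = {{}}"
    by (auto simp: good_partitions_def null_graph_def partition_on_def)
  then show ?thesis
    by (simp add: harary_poly_def harary_coeff_def falling_factorial_poly_def null_graph_def)
qed

text \<open>Deletion-contraction is the case \<alpha> = -1, \<beta> = 0 of edge elimination.
  Agreement on simple graphs suffices, because the defining conditions only evaluate
  \<open>F\<close> there.\<close>

lemma EE_invariant_if_chromatic:
  assumes F: "\<And>G. simple_graph G \<Longrightarrow> F G = chromatic_poly G"
  shows "EE_invariant F"
  unfolding EE_invariant_def
proof (intro conjI exI allI impI)
  show "graph_parameter F"
    using chromatic_poly_iso by (auto simp: graph_parameter_def F)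
  show "F G = F (delete_edge G u v) + (-1) * F (contract_edge G u v) + 0 * F (extract_edge G u v)"
    if "simple_graph G \<and> {u, v} \<in> edges G" for G u v
  proof -
    have "simple_graph G" "simple_graph (delete_edge G u v)" "simple_graph (contract_edge G u v)"
      using that by (auto intro: simple_graph_delete_edge simple_graph_contract_edge)
    then show ?thesis
      using that by (intro poly_eqI_nat) (simp add: F poly_chromatic_poly card_proper_colourings_delete_edge)
  qed
  have "simple_graph (null_graph :: nat ugraph)" by (simp add: simple_graph_def null_graph_def)
  then show "F null_graph = 1"
    by (simp add: F chromatic_poly_eq_harary_poly harary_poly_null_graph)
  \<comment> \<open>\<gamma> is the polynomial x, as a single vertex has k colourings.\<close>
  show "F ({v}, {}) = [:0, 1:]" for v
  proof -
    have "simple_graph ({v}, {})" by (simp add: simple_graph_def)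
    then show ?thesis
      by (intro poly_eqI_nat)
         (simp add: F poly_chromatic_poly proper_colourings_def card_PiE)
  qed
  show "F (graph_union G H) = F G * F H"
    if "simple_graph G \<and> simple_graph H \<and> verts G \<inter> verts H = {}" for G H
    using that by (intro poly_eqI_nat)
      (simp add: F poly_chromatic_poly card_proper_colourings_union simple_graph_union)
qed

section \<open>Harary polynomials that are edge elimination invariants\<close>

text \<open>With one colour the only map is constant, and its only colour class is the whole vertex
  set. A graph without vertices has no class and always gives 1, which matches the indicator because
  \<open>null_graph\<close> is in \<open>P\<close>.\<close>

lemma poly_harary_poly_1:
  assumes "simple_graph G" "null_graph \<in> P"
  shows "poly (harary_poly P G) 1 = of_bool (G \<in> P)"
proof (cases "verts G = {}")
  case True
  then have "G = null_graph"
    using assms(1) by (cases G) (auto simp: simple_graph_def null_graph_def)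
  then show ?thesis using assms(2) by (simp add: harary_poly_null_graph)
next
  case False
  let ?c = "\<lambda>v\<in>verts G. 1 :: nat"
  have img: "?c ` verts G = {1}" using False by auto
  have "P_colourings P G 1 =
      {c \<in> {?c}. \<forall>i\<in>c ` verts G. induced_subgraph G {v \<in> verts G. c v = i} \<in> P}"
    unfolding P_colourings_def
    by (auto simp: PiE_def extensional_def fun_eq_iff Pi_def)
  also have "\<dots> = (if G \<in> P then {?c} else {})"
    using img induced_subgraph_verts[OF assms(1)] by auto
  finally show ?thesis using poly_harary_poly[OF assms(1), of P 1] by simp
qed

lemma EE_invariant_imp_edgeless:
  assumes property: "graph_property P" and nontriv: "\<not> trivial_property P"
    and her: "hereditary_property P" and EE: "EE_invariant (harary_poly P)"
  shows "P = {H. simple_graph H \<and> edges H = {}}"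
proof -
  have simple: "simple_graph G" if "G \<in> P" for G
    using that property by (auto simp: graph_property_def)
  have ind: "induced_subgraph G W \<in> P" if "G \<in> P" "W \<subseteq> verts G" for G W
    using that her by (auto simp: hereditary_property_def)
  obtain G0 v0 where G0: "G0 \<in> P" "v0 \<in> verts G0"
    using infinite_property_nonempty_graph[OF property] nontriv by (auto simp: trivial_property_def)
  have "induced_subgraph G0 {} = null_graph"
    using simple[OF G0(1)] by (auto simp: induced_subgraph_def null_graph_def simple_graph_def)
  then have null: "null_graph \<in> P" using ind[OF G0(1), of "{}"] by simp
  note at_1 = poly_harary_poly_1[OF _ null]
  obtain \<alpha> \<beta> \<gamma> where
    elimination: "\<And>G u v. simple_graph G \<Longrightarrow> {u, v} \<in> edges G \<Longrightarrow>
        harary_poly P G = harary_poly P (delete_edge G u v)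
          + \<alpha> * harary_poly P (contract_edge G u v) + \<beta> * harary_poly P (extract_edge G u v)"
    and singleton: "\<And>v. harary_poly P ({v}, {}) = \<gamma>"
    and disjoint_union: "\<And>G H. simple_graph G \<Longrightarrow> simple_graph H \<Longrightarrow> verts G \<inter> verts H = {} \<Longrightarrow>
        harary_poly P (graph_union G H) = harary_poly P G * harary_poly P H"
    using EE unfolding EE_invariant_def by blast
  \<comment> \<open>Read at 1, the recurrence relates four membership statements.\<close>
  have elim_1: "of_bool (G \<in> P) = of_bool (delete_edge G u v \<in> P)
      + poly \<alpha> 1 * of_bool (contract_edge G u v \<in> P)
      + poly \<beta> 1 * of_bool (extract_edge G u v \<in> P)"
    if "simple_graph G" "{u, v} \<in> edges G" for G u v
    using arg_cong[OF elimination[OF that], of "\<lambda>p. poly p 1"] that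
    by (simp add: at_1 simple_graph_delete_edge simple_graph_contract_edge
        simple_graph_induced_subgraph extract_edge_def)
  \<comment> \<open>At 1, multiplicativity says that the indicator of a disjoint union is the
    product of the indicators.\<close>
  have union_P: "graph_union G H \<in> P" if "G \<in> P" "H \<in> P" "verts G \<inter> verts H = {}" for G H
    using arg_cong[OF disjoint_union[OF simple simple, OF that], of "\<lambda>p. poly p 1"] that simple
    by (simp add: at_1 simple_graph_union split: if_splits)
  have simple1: "simple_graph ({v}, {})" for v :: nat by (simp add: simple_graph_def)
  have "({v0}, {}) \<in> P"
    using ind[OF G0(1), of "{v0}"] G0(2) simple[OF G0(1)] by (simp add: induced_subgraph_singleton)
  \<comment> \<open>All one-vertex graphs share the polynomial \<gamma>, so membership of one of
    them carries over to all.\<close>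
  then have single_P: "({v}, {}) \<in> P" for v
    using at_1[OF simple1, of v] at_1[OF simple1, of v0] by (simp add: singleton split: if_splits)
  have edgeless: "(V, {}) \<in> P" if "finite V" for V
    using that
  proof (induction V)
    case empty
    then show ?case using null by (simp add: null_graph_def)
  next
    case (insert v V)
    then have "graph_union ({v}, {}) (V, {}) \<in> P" by (intro union_P single_P) auto
    then show ?case by (simp add: graph_union_def)
  qed
  have no_edge: "edges G = {}" if G: "G \<in> P" for G
  proof (rule ccontr)
    assume "edges G \<noteq> {}"
    then obtain u v where e: "{u, v} \<in> edges G" and uv: "u \<in> verts G" "v \<in> verts G" "u \<noteq> v"
      using simple[OF G] unfolding simple_graph_def by (metis card_2_iff ex_in_conv insert_subset)
    let ?K = "({u, v}, {{u, v}}) :: nat ugraph"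
    have "?K \<in> P"
      using ind[OF G, of "{u, v}"] uv induced_subgraph_edge[OF simple[OF G] e] by simp
    moreover have "simple_graph ?K" using uv(3) by (simp add: simple_graph_def)
    moreover have "delete_edge ?K u v = ({u, v}, {})"
      and "contract_edge ?K u v = ({u}, {})" and "extract_edge ?K u v = null_graph"
      using uv(3) by (auto simp: delete_edge_def contract_edge_def extract_edge_def
          induced_subgraph_def null_graph_def)
    \<comment> \<open>K2 and the three graphs derived from it all lie in \<open>P\<close>, so every
      indicator is 1.\<close>
    ultimately have K: "poly \<alpha> 1 + poly \<beta> 1 = 0"
      using elim_1[of ?K u v] null single_P edgeless by simp
    let ?bad = "\<lambda>H. simple_graph H \<and> H \<notin> P"
    have "\<exists>H. ?bad H" using nontriv by (auto simp: trivial_property_def)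
    \<comment> \<open>Lexicographic minimisation in two stages: the vertex count puts contractions
      and extractions of the chosen graph into \<open>P\<close>; the edge count, at that fixed
      number of vertices, handles edge deletion.\<close>
    then obtain H0 where H0: "?bad H0"
      and min0: "\<And>H. ?bad H \<Longrightarrow> card (verts H0) \<le> card (verts H)"
      using ex_has_least_nat[of ?bad _ "\<lambda>H. card (verts H)"] by blast
    let ?bad' = "\<lambda>H. ?bad H \<and> card (verts H) = card (verts H0)"
    obtain H where H: "?bad' H"
      and min: "\<And>H'. ?bad' H' \<Longrightarrow> card (edges H) \<le> card (edges H')"
      using ex_has_least_nat[of ?bad' H0 "\<lambda>H. card (edges H)"] H0 by blast
    have sH: "simple_graph H" and finV: "finite (verts H)"
      using H by (auto simp: simple_graph_def)
    have finE: "finite (edges H)"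
      using sH by (auto simp: simple_graph_def intro: rev_finite_subset[of "Pow (verts H)"])
    have small: "H' \<in> P" if "simple_graph H'" "verts H' \<subset> verts H" for H'
    proof (rule ccontr)
      assume "H' \<notin> P"
      then have "card (verts H0) \<le> card (verts H')" using min0 that(1) by blast
      then show False using psubset_card_mono[OF finV that(2)] H by simp
    qed
    \<comment> \<open>Edgeless graphs lie in \<open>P\<close>, so the minimal counterexample has an
      edge to eliminate.\<close>
    have "edges H \<noteq> {}" using H edgeless[OF finV] by (cases H) auto
    then obtain x y where e: "{x, y} \<in> edges H" and xy: "x \<in> verts H" "y \<in> verts H"
      using sH unfolding simple_graph_def by (metis card_2_iff ex_in_conv insert_subset)
    have "card (edges (delete_edge H x y)) < card (edges H)"
      using card_Diff1_less[OF finE e] by (simp add: delete_edge_def)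
    then have "delete_edge H x y \<in> P"
      using min[of "delete_edge H x y"] simple_graph_delete_edge[OF sH] H
      by (auto simp: delete_edge_def)
    moreover have "contract_edge H x y \<in> P"
      using xy by (intro small simple_graph_contract_edge[OF sH e]) (auto simp: contract_edge_def)
    moreover have "extract_edge H x y \<in> P"
      unfolding extract_edge_def using xy
      by (intro small simple_graph_induced_subgraph[OF sH]) (auto simp: induced_subgraph_def)
    \<comment> \<open>The left side is 0, while the right side is 1 + \<alpha>(1) + \<beta>(1) = 1
      by \<open>K\<close>.\<close>
    ultimately show False using elim_1[OF sH e] K H by simp
  qed
  show ?thesis
  proof (intro equalityI subsetI)
    show "G \<in> {H. simple_graph H \<and> edges H = {}}" if "G \<in> P" for G
      using simple[OF that] no_edge[OF that] by simp
    show "G \<in> P" if "G \<in> {H. simple_graph H \<and> edges H = {}}" for G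
      using that edgeless[of "verts G"] by (cases G) (auto simp: simple_graph_def)
  qed
qed

theorem theorem10:
  fixes P :: "nat ugraph set"
  assumes "graph_property P"
    and "\<not> trivial_property P"
    and "minor_closed_property P \<or> monotone_property P \<or> hereditary_property P"
  shows "EE_invariant (harary_poly P) \<longleftrightarrow>
           (\<forall>G. simple_graph G \<longrightarrow> harary_poly P G = chromatic_poly G)"
proof
  assume "EE_invariant (harary_poly P)"
  moreover have "hereditary_property P"
    using assms(1,3) minor_closed_imp_hereditary monotone_imp_hereditary by blast
  ultimately have "P = {H. simple_graph H \<and> edges H = {}}"
    using EE_invariant_imp_edgeless assms(1,2) by blast
  then show "\<forall>G. simple_graph G \<longrightarrow> harary_poly P G = chromatic_poly G"
    by (simp add: chromatic_poly_eq_harary_poly)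
qed (blast intro: EE_invariant_if_chromatic)

end
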